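(* Let $\nu>0$ and $\lambda\ge 0$, and let $p_{\nu,\lambda}$ be the noncentral $\chi^2$ density on $(0,\infty)$ with $\nu$ degrees of freedom and noncentrality parameter $\lambda$. Let $\lambda_\nu$, $0<\nu\le 2$, be the critical value defined in the context. Then: (i) $p_{\nu,\lambda}$ is log-concave if and only if $\nu\ge 2$; (ii) $p_{\nu,\lambda}$ is strictly log-convex for small $x$ and strictly log-concave afterwards (that is, there is $\tilde x\in(0,\infty)$ such that $\log p_{\nu,\lambda}$ is strictly convex on $(0,\tilde x)$ and strictly concave on $(\tilde x,\infty)$) if and only if $0<\nu<2$ and $\lambda>0$; (iii) $p_{\nu,\lambda}$ is decreasing on $(0,\infty)$ if and only if $0<\nu\le 2$ and $\lambda\le\lambda_\nu$; (iv) $p_{\nu,\lambda}$ is bi-modal if and only if $0<\nu<2$ and $\lambda>\lambda_\nu$.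
   Context: Densities. For $\nu>0$ and $x>0$ let $p_{\nu,0}(x)=\frac{e^{-x/2}}{2\Gamma(\nu/2)}\left(\frac{x}{2}\right)^{\nu/2-1}$. For $\lambda\ge 0$ (with $0^0=1$) let $$p_{\nu,\lambda}(x)=\sum_{k=0}^\infty \frac{e^{-\lambda/2}}{k!}\left(\frac{\lambda}{2}\right)^k p_{\nu+2k,0}(x),\quad x>0.$$ The parameter $\nu$ need not be an integer. Critical value. Let $I_\mu(x)=\sum_{k=0}^\infty \frac{(x/2)^{2k+\mu}}{k!\,\Gamma(\mu+k+1)}$ be the modified Bessel function of the first kind, and $r_\mu(x)=I_\mu(x)/I_{\mu-1}(x)$ for $\mu>0$, $x>0$. For $\nu\in(0,2)$ and $\lambda>4-\nu$ let $$g_\nu(\lambda)=r_{\nu/2}\left(\sqrt{\lambda(\lambda+\nu-4)}\right)-\frac{\lambda-2}{\sqrt{\lambda(\lambda+\nu-4)}}.$$ For $\nu\in(0,2)$, $\lambda_\nu$ is the unique number in $(4-\nu,\infty)$ such that $g_\nu(\lambda)>0$ for $\lambda>\lambda_\nu$ and $g_\nu(\lambda)<0$ for $4-\nu<\lambda<\lambda_\nu$. For $\nu=2$, set $\lambda_2=2$. Shape terminology. A nonnegative function $f$ on $(0,\infty)$ is log-concave (log-convex) if $\log f$ is concave (convex). Increasing and decreasing are meant in the strict sense. The density $p_{\nu,\lambda}$ is bi-modal if it has one mode at zero and a second mode in $(0,\infty)$: there exist $0<m<M<\infty$ such that $p_{\nu,\lambda}$ is decreasing on $(0,m]$, increasing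 on $[m,M]$, and decreasing on $[M,\infty)$. *)

theory Defs
  imports "HOL-Analysis.Analysis"
begin

section \<open>Central and noncentral chi-squared densities\<close>

text \<open>
  The densities live on the open half-line: the values at \<open>x \<le> 0\<close> are
  artefacts of total functions and are never used. The degrees of freedom \<open>\<nu>\<close> are an
  arbitrary positive real.
\<close>

definition chi2_density :: "real \<Rightarrow> real \<Rightarrow> real" where
  "chi2_density \<nu> x = exp (- x / 2) / (2 * Gamma (\<nu> / 2)) * (x / 2) powr (\<nu> / 2 - 1)"

definition noncentral_chi2_density :: "real \<Rightarrow> real \<Rightarrow> real \<Rightarrow> real" where
  "noncentral_chi2_density \<nu> l x =
     (\<Sum>k. exp (- l / 2) / fact k * (l / 2) ^ k * chi2_density (\<nu> + 2 * real k) x)"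

text \<open>
  The series converges to a positive value for all \<open>\<nu> > 0\<close>, \<open>l \<ge> 0\<close>, \<open>x > 0\<close>, so neither the
  default value of \<^const>\<open>suminf\<close> nor that of \<^term>\<open>ln 0\<close> (used below) plays a role.
\<close>

lemma summable_noncentral_chi2_density:
  assumes "\<nu> > 0" "l \<ge> 0" "x > 0"
  shows "summable (\<lambda>k. exp (- l / 2) / fact k * (l / 2) ^ k * chi2_density (\<nu> + 2 * real k) x)"
    (is "summable ?f")
proof (rule summable_ratio_test[where c = "1 / 2" and N = "nat \<lceil>l * x / 2\<rceil> + 1"])
  fix n assume n: "n \<ge> nat \<lceil>l * x / 2\<rceil> + 1"
  define a where "a = \<nu> / 2 + real n"
  have n1: "real n \<ge> 1" and n2: "real n \<ge> l * x / 2"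
    using n by linarith+
  have a: "a \<ge> 1" using n1 assms by (simp add: a_def)
  have G: "Gamma (a + 1) = a * Gamma a"
    using a by (intro Gamma_plus1) (auto elim!: nonpos_Ints_cases)
  have p: "(x / 2) powr (a + 1 - 1) = (x / 2) powr (a - 1) * (x / 2)"
    using assms by (simp add: powr_diff)
  have e1: "(\<nu> + 2 * real n) / 2 = a" and e2: "(\<nu> + 2 * real (Suc n)) / 2 = a + 1"
    by (simp_all add: a_def field_simps)
  have eq: "?f (Suc n) = ?f n * ((l * x / 4) / ((real n + 1) * a))"
    unfolding chi2_density_def e1 e2 G p using a by (simp add: field_simps)
  have nonneg: "?f n \<ge> 0"
    unfolding chi2_density_def e1 using assms a by (intro mult_nonneg_nonneg divide_nonneg_nonneg) (auto intro: less_imp_le)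
  have "real n + 1 \<le> (real n + 1) * a" using a by (simp add: mult_le_cancel_left1)
  hence "l * x / 4 \<le> 1 / 2 * ((real n + 1) * a)" and d: "(real n + 1) * a > 0"
    using n2 by linarith+
  hence r: "(l * x / 4) / ((real n + 1) * a) \<le> 1 / 2"
    by (simp only: pos_divide_le_eq)
  have r0: "(l * x / 4) / ((real n + 1) * a) \<ge> 0"
    using assms a by simp
  show "norm (?f (Suc n)) \<le> 1 / 2 * norm (?f n)"
    unfolding eq real_norm_def abs_mult[of "?f n"] abs_of_nonneg[OF nonneg] abs_of_nonneg[OF r0]
    using mult_left_mono[OF r nonneg] by (simp only: mult.commute)
qed simp

lemma noncentral_chi2_density_pos:
  assumes "\<nu> > 0" "l \<ge> 0" "x > 0"
  shows "noncentral_chi2_density \<nu> l x > 0"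
  unfolding noncentral_chi2_density_def
proof (rule suminf_pos2[where i = 0, OF summable_noncentral_chi2_density[OF assms]])
  fix n show "0 \<le> exp (- l / 2) / fact n * (l / 2) ^ n * chi2_density (\<nu> + 2 * real n) x"
    unfolding chi2_density_def using assms
    by (intro mult_nonneg_nonneg divide_nonneg_nonneg) (auto intro!: less_imp_le Gamma_real_pos)
qed (use assms in \<open>auto simp: chi2_density_def\<close>)

section \<open>The critical noncentrality parameter\<close>

definition bessel_I :: "real \<Rightarrow> real \<Rightarrow> real" where
  "bessel_I \<mu> x = (\<Sum>k. (x / 2) powr (2 * real k + \<mu>) / (fact k * Gamma (\<mu> + real k + 1)))"

definition bessel_ratio :: "real \<Rightarrow> real \<Rightarrow> real" where
  "bessel_ratio \<mu> x = bessel_I \<mu> x / bessel_I (\<mu> - 1) x"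

definition crit_fun :: "real \<Rightarrow> real \<Rightarrow> real" where
  "crit_fun \<nu> l = bessel_ratio (\<nu> / 2) (sqrt (l * (l + \<nu> - 4)))
                   - (l - 2) / sqrt (l * (l + \<nu> - 4))"

text \<open>Meaningful only for \<open>0 < \<nu> \<le> 2\<close>.\<close>

definition crit_value :: "real \<Rightarrow> real" where
  "crit_value \<nu> =
     (if \<nu> = 2 then 2
      else (THE c. c > 4 - \<nu> \<and> (\<forall>l. c < l \<longrightarrow> crit_fun \<nu> l > 0) \<and>
                   (\<forall>l. 4 - \<nu> < l \<and> l < c \<longrightarrow> crit_fun \<nu> l < 0)))"

section \<open>Shape notions\<close>

definition strictly_convex_on :: "real set \<Rightarrow> (real \<Rightarrow> real) \<Rightarrow> bool" where
  "strictly_convex_on S f \<longleftrightarrow> convex S \<and>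
     (\<forall>x\<in>S. \<forall>y\<in>S. \<forall>u>0. \<forall>v>0. x \<noteq> y \<longrightarrow> u + v = 1 \<longrightarrow>
        f (u * x + v * y) < u * f x + v * f y)"

definition strictly_concave_on :: "real set \<Rightarrow> (real \<Rightarrow> real) \<Rightarrow> bool" where
  "strictly_concave_on S f \<longleftrightarrow> strictly_convex_on S (\<lambda>x. - f x)"

text \<open>
  Only for functions that are positive on \<open>(0, \<infinity>)\<close>, since the logarithm is real-valued.
\<close>

definition log_concave :: "(real \<Rightarrow> real) \<Rightarrow> bool" where
  "log_concave f \<longleftrightarrow> concave_on {0<..} (\<lambda>x. ln (f x))"

definition bimodal :: "(real \<Rightarrow> real) \<Rightarrow> bool" where
  "bimodal f \<longleftrightarrow>
     (\<exists>m M. 0 < m \<and> m < M \<and> strict_antimono_on {0<..m} f \<and>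
            strict_mono_on {m..M} f \<and> strict_antimono_on {M..} f)"

end

theory Submission
  imports Defs
begin

text \<open>
  Put \<open>a = \<nu> / 2\<close> and \<open>F\<^sub>a(t) = \<Sum>k. t\<^sup>k / (k! \<Gamma>(a + k))\<close>. Up to a factor independent of \<open>x\<close> the density is
  \<open>e\<^bsup>-x/2\<^esup> x\<^bsup>a-1\<^esup> F\<^sub>a(l x / 4)\<close>, so everything is governed by \<open>w(t) = t F\<^sub>a'(t) / F\<^sub>a(t)\<close>, which satisfies
  the Riccati equation \<open>t w' = t + (1 - a) w - w\<^sup>2\<close>. With \<open>K = a w + w\<^sup>2 - t\<close> the score \<open>\<phi> = (ln p)'\<close> satisfies
  \<open>x \<phi> = a - 1 + w(l x / 4) - x / 2\<close> and \<open>x\<^sup>2 \<phi>' = 1 - a - K(l x / 4)\<close>. The equations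
  \<open>t w' = w - K\<close> and \<open>t K' = w\<^sup>2 + K (1 - a - 2 w)\<close> give \<open>0 < K < w\<close>, and for \<open>a < 1\<close> they make \<open>K\<close> cross the
  level \<open>1 - a\<close> exactly once, upwards, at some \<open>t0\<close>. Hence \<open>\<phi>\<close> increases up to \<open>x0 = 4 t0 / l\<close> and
  decreases afterwards, and only the sign of \<open>\<phi>(x0)\<close> matters. As \<open>K(t0) = 1 - a\<close> factors into
  \<open>t0 = (w0 + 1) (w0 - (1 - a))\<close> with \<open>w0 = w(t0)\<close>, that sign is the sign of \<open>l - 2 (w0 + 1)\<close>; the same
  factorisation shows that \<open>2 (w0 + 1)\<close> is the critical value. Below, \<open>F\<^sub>a\<close>, \<open>w\<close>, \<open>K\<close>, \<open>\<phi>\<close> are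
  \<open>hyp01 a\<close>, \<open>hyp01_quot a\<close>, \<open>hyp01_curv a\<close>, \<open>chi2_score \<nu> l\<close>.
\<close>

section \<open>Sign changes and convexity on the line\<close>

text \<open>At the first zero after a point where \<open>f\<close> is positive, the positive
  derivative would make \<open>f\<close> negative just to the left. A differential equation thus
  needs inspection only at zeros; the sign arguments for \<open>w'\<close> and \<open>K\<close> rest
  on this.\<close>

lemma upcrossing_pos:
  fixes f f' :: "real \<Rightarrow> real"
  assumes der: "\<And>t. t > 0 \<Longrightarrow> (f has_real_derivative f' t) (at t)"
    and up: "\<And>t. t > 0 \<Longrightarrow> f t = 0 \<Longrightarrow> f' t > 0"
    and s: "0 < s" "s < t" "f s \<ge> 0"
  shows "f t > 0"
proof (rule ccontr)
  assume "\<not> f t > 0"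
  then have ft: "f t \<le> 0" by simp
  have cont: "continuous_on {u..t} f" if "u > 0" for u
    using that by (intro continuous_at_imp_continuous_on ballI DERIV_isCont[OF der]) auto
  \<comment> \<open>Since \<open>f s = 0\<close> is allowed, the search for a zero starts at a point
    of strict positivity, which the derivative at \<open>s\<close> supplies in that case.\<close>
  obtain u where u: "s \<le> u" "u < t" "f u > 0"
  proof (cases "f s = 0")
    case True
    then obtain d where d: "d > 0" "\<And>h. h > 0 \<Longrightarrow> h < d \<Longrightarrow> f s < f (s + h)"
      using DERIV_pos_inc_right[OF der[OF s(1)] up[OF s(1)]] by blast
    define h where "h = min (d / 2) ((t - s) / 2)"
    have "h > 0" "h < d" "s + h < t"
      using d(1) s by (auto simp: h_def min_def field_simps)
    then show ?thesis using that[of "s + h"] d(2)[of h] True by simp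
  qed (use s that[of s] in auto)
  define A where "A = {u..t} \<inter> f -` {..0}"
  have "closed A"
    unfolding A_def using cont[of u] u s by (intro continuous_closed_preimage) auto
  moreover have A: "t \<in> A" "bdd_below A" using ft u by (auto simp: A_def)
  ultimately have zA: "Inf A \<in> A" by (intro closed_contains_Inf) auto
  define z where "z = Inf A"
  have z: "u \<le> z" "z \<le> t" "f z \<le> 0" using zA by (auto simp: A_def z_def)
  have zu: "u < z" using z u by (cases "u = z") auto
  have before: "f v > 0" if "u \<le> v" "v < z" for v
  proof (rule ccontr)
    assume "\<not> f v > 0"
    then have "v \<in> A" using that z by (auto simp: A_def)
    then show False using cInf_lower[OF _ A(2), of v] that by (simp add: z_def)
  qed
  have "f z = 0"
  proof (rule ccontr)
    assume "f z \<noteq> 0"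
    then have "f z < 0" using z by simp
    then obtain v where v: "u \<le> v" "v \<le> z" "f v = 0"
      using IVT2'[of f z 0 u] zu u cont[of u] s z
      by (metis atLeastatMost_subset_iff continuous_on_subset less_eq_real_def less_le_trans order_refl)
    then show False using before[of v] \<open>f z \<noteq> 0\<close> by (cases "v = z") auto
  qed
  moreover have z0: "z > 0" using zu u s by simp
  ultimately obtain d where d: "d > 0" "\<And>h. h > 0 \<Longrightarrow> h < d \<Longrightarrow> f (z - h) < f z"
    using DERIV_pos_inc_left[OF der[OF z0] up[OF z0]] by blast
  define h where "h = min (d / 2) (z - u)"
  have "h > 0" "h < d" "u \<le> z - h" using d zu by (auto simp: h_def min_def)
  then show False using d(2)[of h] before[of "z - h"] \<open>f z = 0\<close> by simp
qed

text \<open>Supplies starting points for \<open>upcrossing_pos\<close>: the differential equations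
  below are singular at \<open>0\<close>, where only continuity of a suitable quotient
  \<open>q\<close> is at hand.\<close>

lemma isCont_pos_right:
  fixes q :: "real \<Rightarrow> real"
  assumes "isCont q x" "q x > 0" "x < t"
  obtains s where "x < s" "s < t" "q s > 0"
proof -
  have "(q \<longlongrightarrow> q x) (at_right x)"
    using assms(1) by (simp add: isCont_def filterlim_at_split)
  then have "eventually (\<lambda>s. q s > 0) (at_right x)"
    using assms(2) by (rule order_tendstoD)
  moreover have "eventually (\<lambda>s. s \<in> {x<..<t}) (at_right x)"
    using assms(3) by (rule eventually_at_right_real)
  ultimately have "eventually (\<lambda>s. q s > 0 \<and> s \<in> {x<..<t}) (at_right x)"
    by (rule eventually_conj)
  then show ?thesis
    using that eventually_happens'[OF trivial_limit_at_right_real] by fastforce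
qed

text \<open>The mean value theorem on both sides of \<open>z\<close> represents the two chord slopes
  by \<open>f' p < f' q\<close>; weighting with \<open>u * v * (y - x)\<close> gives the convexity
  inequality.\<close>

lemma strictly_convex_onI_deriv:
  fixes f f' :: "real \<Rightarrow> real"
  assumes S: "convex S"
    and der: "\<And>x. x \<in> S \<Longrightarrow> (f has_real_derivative f' x) (at x)"
    and mono: "strict_mono_on S f'"
  shows "strictly_convex_on S f"
proof -
  have main: "f (u * x + v * y) < u * f x + v * f y"
    if xy: "x \<in> S" "y \<in> S" "x < y" and uv: "u > 0" "v > 0" "u + v = 1" for x y u v
  proof -
    define z where "z = u * x + v * y"
    have u: "u = 1 - v" using uv by simp
    have zx: "z - x = v * (y - x)" and yz: "y - z = u * (y - x)"
      by (simp_all add: z_def u algebra_simps)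
    have "z - x > 0" "y - z > 0" unfolding zx yz using xy uv by simp_all
    then have z: "x < z" "z < y" by simp_all
    have S': "\<xi> \<in> S" if "x \<le> \<xi>" "\<xi> \<le> y" for \<xi>
      using S xy that by (meson is_interval_convex_1 mem_is_interval_1_I)
    obtain p where p: "x < p" "p < z" "f z - f x = (z - x) * f' p"
      using MVT2[OF z(1), of f f'] der S' z by (smt (verit, best))
    obtain q where q: "z < q" "q < y" "f y - f z = (y - z) * f' q"
      using MVT2[OF z(2), of f f'] der S' z by (smt (verit, best))
    have "f' p < f' q"
      using strict_mono_onD[OF mono, of p q] p q S' z by simp
    then have "u * v * (y - x) * f' p < u * v * (y - x) * f' q"
      using uv xy by simp
    then have "u * (f z - f x) < v * (f y - f z)"
      unfolding p(3) q(3) zx yz by (simp add: ac_simps)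
    then have "(u + v) * f z < u * f x + v * f y" by (simp add: algebra_simps)
    then show ?thesis using uv by (simp add: z_def)
  qed
  show ?thesis unfolding strictly_convex_on_def
  proof (intro conjI S ballI allI impI)
    fix x y u v :: real
    assume *: "x \<in> S" "y \<in> S" "u > 0" "v > 0" "x \<noteq> y" "u + v = 1"
    show "f (u * x + v * y) < u * f x + v * f y"
    proof (cases "x < y")
      case True then show ?thesis using main * by blast
    next
      case False
      then show ?thesis using main[of y x v u] * by (simp add: add.commute)
    qed
  qed
qed

lemma strictly_convex_on_subset:
  assumes "strictly_convex_on S f" "T \<subseteq> S" "convex T"
  shows "strictly_convex_on T f"
  using assms unfolding strictly_convex_on_def by blast

lemma strictly_convex_imp_not_concave:
  fixes S T :: "real set"
  assumes "strictly_convex_on S f" "concave_on T f" "S \<subseteq> T" "x \<in> S" "y \<in> S" "x \<noteq> y"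
  shows False
proof -
  have "f (1/2 * x + 1/2 * y) < 1/2 * f x + 1/2 * f y"
    using assms unfolding strictly_convex_on_def by (metis add_divide_distrib half_gt_zero_iff one_add_one div_self zero_less_one zero_neq_numeral)
  moreover have "x \<in> T" "y \<in> T" using assms by auto
  then have "1/2 * f x + 1/2 * f y \<le> f (1/2 * x + 1/2 * y)"
    using concave_onD[OF assms(2), of "1/2" x y] by simp
  ultimately show False by simp
qed

lemma strictly_concave_imp_concave:
  assumes "strictly_concave_on S f"
  shows "concave_on S f"
  unfolding concave_on_def
proof (rule convex_onI)
  show "convex S" using assms by (simp add: strictly_concave_on_def strictly_convex_on_def)
  fix t x y assume *: "0 < (t::real)" "t < 1" "x \<in> S" "y \<in> S"
  show "- f ((1 - t) *\<^sub>R x + t *\<^sub>R y) \<le> (1 - t) * - f x + t * - f y"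
  proof (cases "x = y")
    case True then show ?thesis by (simp add: algebra_simps)
  next
    case False
    have "1 - t > 0" "1 - t + t = 1" using * by auto
    then show ?thesis using assms * False
      unfolding strictly_concave_on_def strictly_convex_on_def
      by (metis less_eq_real_def real_scaleR_def)
  qed
qed

section \<open>The function \<open>F\<^sub>a\<close> and its logarithmic derivative\<close>

text \<open>The regularised hypergeometric function \<open>0F1(; a; t) / Gamma a\<close>. With this
  normalisation differentiation just shifts \<open>a\<close> to \<open>a + 1\<close>.\<close>

definition hyp01 :: "real \<Rightarrow> real \<Rightarrow> real" where
  "hyp01 a t = (\<Sum>k. inverse (fact k * Gamma (a + real k)) * t ^ k)"

lemma Gamma_plus1_pos: "a > 0 \<Longrightarrow> Gamma (a + 1) = a * Gamma (a::real)"
  by (intro Gamma_plus1) (auto elim!: nonpos_Ints_cases)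

lemma summable_hyp01:
  assumes "a > 0"
  shows "summable (\<lambda>k. inverse (fact k * Gamma (a + real k)) * t ^ k)" (is "summable ?f")
proof (rule summable_ratio_test[where c = "1 / 2" and N = "nat \<lceil>2 * \<bar>t\<bar>\<rceil> + 1"])
  fix n assume n: "n \<ge> nat \<lceil>2 * \<bar>t\<bar>\<rceil> + 1"
  have n1: "real n \<ge> 1" and n2: "real n \<ge> 2 * \<bar>t\<bar>" using n by linarith+
  have a: "a + real n \<ge> 1" using n1 assms by simp
  have G: "Gamma (a + real (Suc n)) = (a + real n) * Gamma (a + real n)"
    using Gamma_plus1_pos[of "a + real n"] a by (simp add: ac_simps)
  have eq: "?f (Suc n) = ?f n * (t / ((real n + 1) * (a + real n)))"
    unfolding G by (simp add: field_simps)
  have "real n + 1 \<le> (real n + 1) * (a + real n)" using a by (simp add: mult_le_cancel_left1)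
  then have "\<bar>t\<bar> \<le> 1 / 2 * ((real n + 1) * (a + real n))" and d: "(real n + 1) * (a + real n) > 0"
    using n2 by linarith+
  then have "\<bar>t / ((real n + 1) * (a + real n))\<bar> \<le> 1 / 2"
    by (simp only: abs_divide abs_of_pos[OF d] pos_divide_le_eq)
  then show "norm (?f (Suc n)) \<le> 1 / 2 * norm (?f n)"
    unfolding eq real_norm_def abs_mult[of "?f n"]
    using mult_left_mono[of _ _ "\<bar>?f n\<bar>"] by (metis abs_ge_zero mult.commute)
qed simp

lemma has_real_derivative_hyp01:
  assumes "a > 0"
  shows "(hyp01 a has_real_derivative hyp01 (a + 1) t) (at t)"
proof -
  define c where "c = (\<lambda>a k. inverse (fact k * Gamma (a + real k)) :: real)"
  have "diffs (c a) = c (a + 1)"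
    by (rule ext) (simp add: c_def diffs_def field_simps del: of_nat_Suc, simp add: ac_simps)
  moreover have "hyp01 b = (\<lambda>t. \<Sum>k. c b k * t ^ k)" for b
    by (rule ext) (simp add: hyp01_def c_def)
  ultimately show ?thesis
    using termdiffs_strong_converges_everywhere[of "c a" t] summable_hyp01[OF assms]
    by (simp add: c_def)
qed

lemma hyp01_pos:
  assumes "a > 0" "t \<ge> 0"
  shows "hyp01 a t > 0"
  unfolding hyp01_def
proof (rule suminf_pos2[where i = 0, OF summable_hyp01])
  fix n show "0 \<le> inverse (fact n * Gamma (a + real n)) * t ^ n"
    using assms Gamma_real_pos[of "a + real n"] by simp
qed (use assms Gamma_real_pos[of a] in auto)

lemma hyp01_at_0: "hyp01 a 0 = inverse (Gamma a)"
  unfolding hyp01_def by (subst powser_zero) simp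

text \<open>Contiguity relation, equivalent to the differential equation \<open>t F'' + a F' = F\<close>.\<close>

lemma hyp01_contiguous:
  assumes "a > 0"
  shows "hyp01 a t = a * hyp01 (a + 1) t + t * hyp01 (a + 2) t"
proof -
  define c where "c = (\<lambda>a k. inverse (fact k * Gamma (a + real k)) :: real)"
  have sums: "(\<lambda>k. c b k * t ^ k) sums hyp01 b t" if "b > 0" for b
    using summable_sums[OF summable_hyp01[OF that, of t]] by (simp add: hyp01_def c_def)
  \<comment> \<open>Termwise, \<open>t\<close> times the derivative of \<open>hyp01 (a + 1)\<close>.
    Undoing the shift by \<open>Suc\<close> costs nothing, as the factor \<open>real k\<close> kills
    the term of index 0.\<close>
  have "(\<lambda>k. real (Suc k) * c (a + 1) (Suc k) * t ^ Suc k) = (\<lambda>k. t * (c (a + 2) k * t ^ k))"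
  proof
    fix k
    have e: "a + 1 + real (Suc k) = a + 2 + real k" by simp
    show "real (Suc k) * c (a + 1) (Suc k) * t ^ Suc k = t * (c (a + 2) k * t ^ k)"
      unfolding c_def e by (simp add: field_simps del: of_nat_Suc)
  qed
  then have "(\<lambda>k. real (Suc k) * c (a + 1) (Suc k) * t ^ Suc k) sums (t * hyp01 (a + 2) t)"
    using sums_mult[OF sums[of "a + 2"], of t] assms by simp
  then have "(\<lambda>k. real k * c (a + 1) k * t ^ k) sums (t * hyp01 (a + 2) t)"
    using sums_Suc_iff[of "\<lambda>k. real k * c (a + 1) k * t ^ k" "t * hyp01 (a + 2) t"] by simp
  then have "(\<lambda>k. a * (c (a + 1) k * t ^ k) + real k * c (a + 1) k * t ^ k)
      sums (a * hyp01 (a + 1) t + t * hyp01 (a + 2) t)"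
    using sums_add[OF sums_mult[OF sums[of "a + 1"], of a]] assms by simp
  moreover have "a * (c (a + 1) k * t ^ k) + real k * c (a + 1) k * t ^ k = c a k * t ^ k" for k
  proof -
    have "Gamma (a + 1 + real k) = (a + real k) * Gamma (a + real k)"
      using Gamma_plus1_pos[of "a + real k"] assms by (simp add: ac_simps)
    then have "c (a + 1) k = inverse (fact k) * (inverse (a + real k) * inverse (Gamma (a + real k)))"
      unfolding c_def by simp
    then have "c (a + 1) k * (a + real k) = c a k"
      using assms by (simp add: c_def)
    then have "c a k * t ^ k = c (a + 1) k * (a + real k) * t ^ k" by simp
    then show ?thesis by (simp add: algebra_simps)
  qed
  ultimately have "(\<lambda>k. c a k * t ^ k) sums (a * hyp01 (a + 1) t + t * hyp01 (a + 2) t)"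
    by simp
  with sums[OF assms] show ?thesis by (rule sums_unique2)
qed

section \<open>The Riccati equation and bounds for \<open>w\<close> and \<open>K\<close>\<close>

definition hyp01_quot :: "real \<Rightarrow> real \<Rightarrow> real" where
  "hyp01_quot a t = t * hyp01 (a + 1) t / hyp01 a t"

text \<open>For \<open>a > 0\<close> and \<open>t > 0\<close> this is \<open>- t^2\<close> times the
  second derivative of \<open>ln (hyp01 a t)\<close>, so its positivity expresses log-concavity of
  the series.\<close>

definition hyp01_curv :: "real \<Rightarrow> real \<Rightarrow> real" where
  "hyp01_curv a t = a * hyp01_quot a t + (hyp01_quot a t)\<^sup>2 - t"

lemma hyp01_quot_0 [simp]: "hyp01_quot a 0 = 0"
  by (simp add: hyp01_quot_def)

lemma hyp01_curv_0 [simp]: "hyp01_curv a 0 = 0"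
  by (simp add: hyp01_curv_def)

lemma hyp01_quot_pos: "a > 0 \<Longrightarrow> t > 0 \<Longrightarrow> hyp01_quot a t > 0"
  by (simp add: hyp01_quot_def hyp01_pos)

lemma isCont_hyp01: "a > 0 \<Longrightarrow> isCont (hyp01 a) t"
  by (rule DERIV_isCont[OF has_real_derivative_hyp01])

lemma isCont_hyp01_quot: "a > 0 \<Longrightarrow> t \<ge> 0 \<Longrightarrow> isCont (hyp01_quot a) t"
  unfolding hyp01_quot_def using hyp01_pos[of a t]
  by (intro continuous_intros isCont_hyp01) auto

lemma isCont_hyp01_curv: "a > 0 \<Longrightarrow> t \<ge> 0 \<Longrightarrow> isCont (hyp01_curv a) t"
  unfolding hyp01_curv_def by (intro continuous_intros isCont_hyp01_quot) auto

lemma has_real_derivative_hyp01_quot: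
  assumes "a > 0" "t > 0"
  shows "(hyp01_quot a has_real_derivative
    (t + (1 - a) * hyp01_quot a t - (hyp01_quot a t)\<^sup>2) / t) (at t)"
proof -
  define F F1 F2 where "F = hyp01 a t" "F1 = hyp01 (a + 1) t" "F2 = hyp01 (a + 2) t"
  have F: "F > 0" using hyp01_pos[of a t] assms by (simp add: F_F1_F2_def)
  have "t * F2 = F - a * F1"
    using hyp01_contiguous[OF assms(1), of t] by (simp add: F_F1_F2_def)
  \<comment> \<open>Eliminating \<open>F2\<close> closes the derivative of the quotient up in
    \<open>w\<close> alone.\<close>
  then have e: "F1 + t * F2 = F + (1 - a) * F1" by (simp add: algebra_simps)
  have "(hyp01_quot a has_real_derivative ((F1 + t * F2) * F - t * F1 * F1) / (F * F)) (at t)"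
    unfolding hyp01_quot_def[abs_def]
    using has_real_derivative_hyp01[of "a + 1" t] has_real_derivative_hyp01[of a t] assms F
    by (auto intro!: derivative_eq_intros simp: F_F1_F2_def add.assoc)
  moreover have "((F1 + t * F2) * F - t * F1 * F1) / (F * F) =
      (t + (1 - a) * (t * F1 / F) - (t * F1 / F)\<^sup>2) / t"
    unfolding e using F assms by (simp add: field_simps power2_eq_square)
  ultimately show ?thesis by (simp add: hyp01_quot_def F_F1_F2_def)
qed

lemma has_real_derivative_hyp01_curv:
  assumes "a > 0" "t > 0"
  shows "(hyp01_curv a has_real_derivative
    ((hyp01_quot a t)\<^sup>2 + hyp01_curv a t * (1 - a - 2 * hyp01_quot a t)) / t) (at t)"
  unfolding hyp01_curv_def[abs_def] using assms
  by (auto intro!: derivative_eq_intros has_real_derivative_hyp01_quot)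
     (simp add: field_simps power2_eq_square)

text \<open>The left-hand side is \<open>t\<close> times the derivative of \<^term>\<open>hyp01_quot a\<close>.\<close>

lemma hyp01_quot_deriv_pos:
  assumes a: "a > 0" and t: "t > 0"
  shows "t + (1 - a) * hyp01_quot a t - (hyp01_quot a t)\<^sup>2 > 0"
proof -
  define w where "w = hyp01_quot a"
  define D where "D = (\<lambda>t. t + (1 - a) * w t - (w t)\<^sup>2)"
  have dw: "(w has_real_derivative D t / t) (at t)" if "t > 0" for t
    using has_real_derivative_hyp01_quot[OF a that] by (simp add: w_def D_def)
  \<comment> \<open>Wherever \<open>D\<close> vanishes this derivative is \<open>1\<close>, so
    \<open>D\<close> can cross zero only upwards.\<close>
  have dD: "(D has_real_derivative 1 + (1 - a - 2 * w t) * D t / t) (at t)" if "t > 0" for t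
  proof -
    define d where "d = D t / t"
    have "(D has_real_derivative 1 + (1 - a - 2 * w t) * d) (at t)"
      unfolding D_def using dw[OF that, folded d_def]
      by (auto intro!: derivative_eq_intros simp: algebra_simps)
    then show ?thesis by (simp add: d_def)
  qed
  \<comment> \<open>\<open>D\<close> itself vanishes at \<open>0\<close>; dividing out
    \<open>t\<close> leaves \<open>q\<close> with \<open>q 0 = 1 / a\<close>, so \<open>D\<close> is
    positive just to the right of \<open>0\<close>.\<close>
  define R where "R = (\<lambda>t. hyp01 (a + 1) t / hyp01 a t)"
  define q where "q = (\<lambda>t. 1 + (1 - a) * R t - t * (R t)\<^sup>2)"
  have q: "D t = t * q t" for t
    by (simp add: D_def q_def w_def hyp01_quot_def R_def power2_eq_square algebra_simps)
  have "R 0 = inverse (a * Gamma a) / inverse (Gamma a)"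
    by (simp only: R_def hyp01_at_0 Gamma_plus1_pos[OF a])
  then have "R 0 = 1 / a" using less_imp_neq[OF Gamma_real_pos[OF a]] by (simp add: field_simps)
  then have "q 0 = 1 / a" using a by (simp add: q_def field_simps)
  then have "q 0 > 0" using a by simp
  moreover have "isCont q 0"
    unfolding q_def R_def using a hyp01_pos[of a 0]
    by (intro continuous_intros isCont_hyp01) auto
  ultimately obtain s where s: "0 < s" "s < t" "q s > 0"
    using isCont_pos_right[of 0 q] t by blast
  then have "D s \<ge> 0" unfolding q by simp
  then have "D t > 0"
    using upcrossing_pos[OF dD _ s(1,2)] by simp
  then show ?thesis by (simp add: D_def w_def)
qed

text \<open>At a zero of \<open>K\<close> the equation reads \<open>t K' = w^2 > 0\<close>, so
  \<open>K\<close> cannot come back to zero. It starts out positive since \<open>K = t^2 q\<close>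
  with \<open>q 0 = 1 / (a^2 (a + 1))\<close>.\<close>

lemma hyp01_curv_pos:
  assumes a: "a > 0" and t: "t > 0"
  shows "hyp01_curv a t > 0"
proof -
  define q where "q = (\<lambda>t. ((hyp01 (a + 1) t)\<^sup>2 - hyp01 a t * hyp01 (a + 2) t) / (hyp01 a t)\<^sup>2)"
  have q: "hyp01_curv a t = t\<^sup>2 * q t" if "t > 0" for t
  proof -
    define F F1 F2 where "F = hyp01 a t" "F1 = hyp01 (a + 1) t" "F2 = hyp01 (a + 2) t"
    have F: "F > 0" using hyp01_pos[of a t] a that by (simp add: F_F1_F2_def)
    have e: "t * F2 = F - a * F1"
      using hyp01_contiguous[OF a, of t] by (simp add: F_F1_F2_def)
    have "t\<^sup>2 * ((F1\<^sup>2 - F * F2) / F\<^sup>2) = (t\<^sup>2 * F1\<^sup>2 - t * F * (t * F2)) / F\<^sup>2"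
      by (simp add: power2_eq_square algebra_simps)
    also have "\<dots> = a * (t * F1 / F) + (t * F1 / F)\<^sup>2 - t"
      unfolding e using F by (simp add: field_simps power2_eq_square)
    finally show ?thesis by (simp add: q_def hyp01_curv_def hyp01_quot_def F_F1_F2_def)
  qed
  have G: "Gamma (a + 1) = a * Gamma a" "Gamma (a + 2) = (a + 1) * (a * Gamma a)" "Gamma a > 0"
    using Gamma_plus1_pos[of a] Gamma_plus1_pos[of "a + 1"] a by (simp_all add: add.assoc)
  have "q 0 = ((inverse (a * Gamma a))\<^sup>2 - inverse (Gamma a) * inverse ((a + 1) * (a * Gamma a)))
      / (inverse (Gamma a))\<^sup>2"
    by (simp only: q_def hyp01_at_0 G(1,2))
  also have "\<dots> = 1 / (a\<^sup>2 * (a + 1))"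
    using a less_imp_neq[OF G(3)] by (simp add: divide_simps) (simp add: power2_eq_square algebra_simps)
  finally have "q 0 = 1 / (a\<^sup>2 * (a + 1))" .
  then have "q 0 > 0" using a by simp
  moreover have "isCont q 0"
    unfolding q_def using a hyp01_pos[of a 0]
    by (intro continuous_intros isCont_hyp01) auto
  ultimately obtain s where s: "0 < s" "s < t" "q s > 0"
    using isCont_pos_right[of 0 q] t by blast
  then have s0: "hyp01_curv a s \<ge> 0" unfolding q[OF s(1)] by simp
  show ?thesis
  proof (rule upcrossing_pos[OF has_real_derivative_hyp01_curv[OF a] _ s(1,2) s0])
    fix t :: real assume t: "t > 0" and "hyp01_curv a t = 0"
    then show "((hyp01_quot a t)\<^sup>2 + hyp01_curv a t * (1 - a - 2 * hyp01_quot a t)) / t > 0"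
      using hyp01_quot_pos[OF a t] by simp
  qed
qed

text \<open>The difference \<open>w - K\<close> is exactly \<open>t w'\<close>.\<close>

lemma hyp01_curv_less_quot:
  assumes "a > 0" "t > 0"
  shows "hyp01_curv a t < hyp01_quot a t"
  using hyp01_quot_deriv_pos[OF assms] by (simp add: hyp01_curv_def algebra_simps)

lemma hyp01_quot_less:
  assumes "a > 0" "t > 0"
  shows "a * hyp01_quot a t < t"
proof -
  have "a * hyp01 (a + 1) t < hyp01 a t"
    using hyp01_contiguous[of a t] hyp01_pos[of "a + 2" t] assms by simp
  then show ?thesis using assms hyp01_pos[of a t] by (simp add: hyp01_quot_def field_simps)
qed

lemma hyp01_curv_exceeds:
  assumes a: "0 < a" "a < 1"
  shows "\<exists>t>0. hyp01_curv a t > 1 - a"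
proof (rule ccontr)
  assume "\<not> ?thesis"
  then have K: "hyp01_curv a t \<le> 1 - a" if "t > 0" for t using that by force
  define w where "w = hyp01_quot a"
  have wpos: "w t > 0" if "t > 0" for t using hyp01_quot_pos that a by (simp add: w_def)
  \<comment> \<open>Positivity of \<open>K\<close> at 2 rules out \<open>w 2 \<le> 1\<close>, which
    would bound this sum by 2.\<close>
  have "(w 2)\<^sup>2 + a * w 2 > 2"
    using hyp01_curv_pos[of a 2] a by (simp add: hyp01_curv_def w_def)
  moreover have "a * w 2 \<le> w 2" using wpos[of 2] a by (simp add: mult_le_cancel_right1)
  ultimately have w2: "w 2 > 1"
    using power_le_one[of "w 2" 2] wpos[of 2] by linarith
  define c where "c = (w 2 - 1) / 2"
  have c: "c > 0" using w2 by (simp add: c_def)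
  text \<open>\<open>t w' = w - K \<ge> w - 1\<close> makes \<open>w\<close> grow linearly, but \<open>w (w - 1) < t\<close>.\<close>
  have lin: "w t \<ge> 1 + c * t" if "t \<ge> 2" for t
  proof -
    have "(w 2 - 1) / 2 \<le> (w t - 1) / t"
    proof (rule DERIV_nonneg_imp_nondecreasing[OF that], intro exI conjI)
      fix x :: real assume x: "2 \<le> x" "x \<le> t"
      show "((\<lambda>x. (w x - 1) / x) has_real_derivative (1 - hyp01_curv a x) / x\<^sup>2) (at x)"
        unfolding w_def using x a
        by (auto intro!: derivative_eq_intros has_real_derivative_hyp01_quot)
           (simp add: hyp01_curv_def field_simps power2_eq_square)
      show "(1 - hyp01_curv a x) / x\<^sup>2 \<ge> 0" using K[of x] x a by simp
    qed
    then show ?thesis using that by (simp add: c_def field_simps)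
  qed
  have quad: "w t * (w t - 1) < t" if "t > 0" for t
  proof -
    have "w t - a * w t \<le> w t" using wpos[OF that] a by simp
    then show ?thesis
      using hyp01_quot_deriv_pos[of a t] a that
      by (simp add: w_def power2_eq_square algebra_simps)
  qed
  \<comment> \<open>Large enough that the linear bound gives
    \<open>w (w - 1) \<ge> (c t)^2 \<ge> t\<close>.\<close>
  define t where "t = max 2 (1 / c\<^sup>2)"
  have t: "t \<ge> 2" "c\<^sup>2 * t \<ge> 1"
    using c by (auto simp: t_def max_def field_simps)
  have "t \<le> c\<^sup>2 * t * t" using mult_right_mono[OF t(2), of t] t(1) by simp
  also have "\<dots> \<le> (1 + c * t) * (c * t)" using c t by (simp add: power2_eq_square algebra_simps)
  also have "\<dots> \<le> w t * (w t - 1)"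
    using lin[OF t(1)] mult_pos_pos[OF c, of t] t(1) by (intro mult_mono) linarith+
  finally show False using quad[of t] t by simp
qed

text \<open>At a crossing of the level \<open>1 - a\<close> the derivative of \<^term>\<open>hyp01_curv a\<close> is
  \<open>(w - (1 - a))\<^sup>2 / t\<close> with \<open>w = hyp01_quot a t\<close>.\<close>

lemma hyp01_curv_crossing:
  assumes a: "0 < a" "a < 1"
  obtains t0 where "t0 > 0" "hyp01_curv a t0 = 1 - a"
    "\<And>t. 0 \<le> t \<Longrightarrow> t < t0 \<Longrightarrow> hyp01_curv a t < 1 - a" "\<And>t. t0 < t \<Longrightarrow> hyp01_curv a t > 1 - a"
proof -
  obtain T where T: "T > 0" "hyp01_curv a T > 1 - a" using hyp01_curv_exceeds[OF a] by blast
  have "continuous_on {0..T} (hyp01_curv a)"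
    using a by (intro continuous_at_imp_continuous_on ballI isCont_hyp01_curv) auto
  then obtain t0 where t0: "0 \<le> t0" "t0 \<le> T" "hyp01_curv a t0 = 1 - a"
    using IVT'[of "hyp01_curv a" 0 "1 - a" T] T a by auto
  then have pos: "t0 > 0" using a by (cases "t0 = 0") auto
  have cross: "hyp01_curv a t > 1 - a" if "0 < s" "s < t" "hyp01_curv a s \<ge> 1 - a" for s t
  proof -
    have "hyp01_curv a t - (1 - a) > 0"
    proof (rule upcrossing_pos[of "\<lambda>t. hyp01_curv a t - (1 - a)"])
      fix t :: real assume "t > 0"
      then show "((\<lambda>t. hyp01_curv a t - (1 - a)) has_real_derivative
          ((hyp01_quot a t)\<^sup>2 + hyp01_curv a t * (1 - a - 2 * hyp01_quot a t)) / t) (at t)"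
        using a by (auto intro!: derivative_eq_intros has_real_derivative_hyp01_curv)
    next
      fix t :: real assume t: "t > 0" and "hyp01_curv a t - (1 - a) = 0"
      then have e: "hyp01_curv a t = 1 - a" by simp
      \<comment> \<open>\<open>K < w\<close> excludes \<open>w = 1 - a\<close>, so the square is
        strictly positive.\<close>
      then have "hyp01_quot a t > 1 - a" using hyp01_curv_less_quot[of a t] a t by simp
      then have "(hyp01_quot a t - (1 - a))\<^sup>2 > 0" by simp
      then show "((hyp01_quot a t)\<^sup>2 + hyp01_curv a t * (1 - a - 2 * hyp01_quot a t)) / t > 0"
        unfolding e using t by (simp add: power2_eq_square algebra_simps)
    qed (use that in auto)
    then show ?thesis by simp
  qed
  have "hyp01_curv a t < 1 - a" if "0 \<le> t" "t < t0" for t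
    using cross[of t t0] that t0 a by (cases "t = 0") force+
  then show ?thesis using that[OF pos t0(3)] cross[OF pos] t0 by simp
qed

section \<open>The density and the Bessel ratio in terms of \<open>hyp01\<close>\<close>

lemma noncentral_chi2_density_eq:
  assumes "\<nu> > 0" "x > 0"
  shows "noncentral_chi2_density \<nu> l x =
    exp (- l / 2) / 2 * exp (- x / 2) * (x / 2) powr (\<nu> / 2 - 1) * hyp01 (\<nu> / 2) (l * x / 4)"
proof -
  define C where "C = exp (- l / 2) / 2 * exp (- x / 2) * (x / 2) powr (\<nu> / 2 - 1)"
  have eq: "exp (- l / 2) / fact k * (l / 2) ^ k * chi2_density (\<nu> + 2 * real k) x =
      C * (inverse (fact k * Gamma (\<nu> / 2 + real k)) * (l * x / 4) ^ k)" for k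
  proof -
    have e: "(\<nu> + 2 * real k) / 2 = \<nu> / 2 + real k" by (simp add: field_simps)
    have "(x / 2) powr (\<nu> / 2 + real k - 1) = (x / 2) powr (\<nu> / 2 - 1 + real k)"
      by (simp add: algebra_simps)
    also have "\<dots> = (x / 2) powr (\<nu> / 2 - 1) * (x / 2) ^ k"
      using assms by (subst powr_add) (simp add: powr_realpow)
    finally have p: "(x / 2) powr (\<nu> / 2 + real k - 1) = (x / 2) powr (\<nu> / 2 - 1) * (x / 2) ^ k" .
    have q: "(l * x / 4) ^ k = (l / 2) ^ k * (x / 2) ^ k"
      by (simp flip: power_mult_distrib)
    have "E / f * L * (F / (2 * G) * (P * X)) = E / 2 * F * P * (inverse (f * G) * (L * X))"
      for E f L F G P X :: real by (simp add: field_simps)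
    then show ?thesis unfolding chi2_density_def e p q C_def .
  qed
  have "noncentral_chi2_density \<nu> l x = C * hyp01 (\<nu> / 2) (l * x / 4)"
    unfolding noncentral_chi2_density_def eq hyp01_def
    using assms by (intro suminf_mult summable_hyp01) simp
  then show ?thesis by (simp only: C_def)
qed

lemma bessel_I_eq:
  assumes "\<mu> > -1" "z > 0"
  shows "bessel_I \<mu> z = (z / 2) powr \<mu> * hyp01 (\<mu> + 1) (z\<^sup>2 / 4)"
proof -
  have "(z / 2) powr (2 * real k + \<mu>) / (fact k * Gamma (\<mu> + real k + 1)) =
      (z / 2) powr \<mu> * (inverse (fact k * Gamma (\<mu> + 1 + real k)) * (z\<^sup>2 / 4) ^ k)" for k
  proof -
    have "(z / 2) powr (2 * real k + \<mu>) = (z / 2) powr real (2 * k) * (z / 2) powr \<mu>"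
      by (simp add: powr_add)
    also have "(z / 2) powr real (2 * k) = ((z / 2)\<^sup>2) ^ k"
      using assms by (simp only: powr_realpow power_mult half_gt_zero)
    finally have "(z / 2) powr (2 * real k + \<mu>) = (z / 2) powr \<mu> * (z\<^sup>2 / 4) ^ k"
      by (simp add: power_divide)
    moreover have "\<mu> + real k + 1 = \<mu> + 1 + real k" by simp
    ultimately show ?thesis by (simp only: divide_inverse mult_ac)
  qed
  then show ?thesis
    using suminf_mult[OF summable_hyp01[of "\<mu> + 1" "z\<^sup>2 / 4"], of "(z / 2) powr \<mu>"] assms
    by (simp add: bessel_I_def hyp01_def)
qed

text \<open>With \<open>t = z^2 / 4\<close> the powers leave the factor
  \<open>z / 2 = 2 t / z\<close>, which turns the quotient of consecutive series into
  \<open>2 w / z\<close>.\<close>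

lemma bessel_ratio_eq:
  assumes "\<mu> > 0" "z > 0"
  shows "bessel_ratio \<mu> z = 2 * hyp01_quot \<mu> (z\<^sup>2 / 4) / z"
proof -
  have "(z / 2) powr \<mu> = (z / 2) * (z / 2) powr (\<mu> - 1)"
    using assms by (simp add: powr_diff)
  moreover have "(z / 2) powr (\<mu> - 1) > 0" using assms by simp
  ultimately show ?thesis
    using assms hyp01_pos[of \<mu> "z\<^sup>2 / 4"]
    by (simp add: bessel_ratio_def bessel_I_eq hyp01_quot_def power2_eq_square field_simps)
qed

section \<open>The score of the density\<close>

definition chi2_score :: "real \<Rightarrow> real \<Rightarrow> real \<Rightarrow> real" where
  "chi2_score \<nu> l x = (\<nu> / 2 - 1 + hyp01_quot (\<nu> / 2) (l * x / 4) - x / 2) / x"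

lemma has_real_derivative_ln_density:
  assumes "\<nu> > 0" "l \<ge> 0" "x > 0"
  shows "((\<lambda>x. ln (noncentral_chi2_density \<nu> l x)) has_real_derivative chi2_score \<nu> l x) (at x)"
proof -
  have "((\<lambda>x. - l / 2 - ln 2 - x / 2 + (\<nu> / 2 - 1) * ln (x / 2) + ln (hyp01 (\<nu> / 2) (l * x / 4)))
      has_real_derivative chi2_score \<nu> l x) (at x)"
    using assms hyp01_pos[of "\<nu> / 2" "l * x / 4"]
    by (auto intro!: derivative_eq_intros DERIV_chain2[OF has_real_derivative_hyp01])
       (simp add: chi2_score_def hyp01_quot_def field_simps)
  then show ?thesis
  proof (rule has_field_derivative_transform_within_open)
    fix y :: real assume "y \<in> {0<..}"
    then show "- l / 2 - ln 2 - y / 2 + (\<nu> / 2 - 1) * ln (y / 2) + ln (hyp01 (\<nu> / 2) (l * y / 4)) =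
        ln (noncentral_chi2_density \<nu> l y)"
      using assms hyp01_pos[of "\<nu> / 2" "l * y / 4"]
      by (simp add: noncentral_chi2_density_eq ln_mult ln_div ln_powr)
  qed (use assms in auto)
qed

lemma has_real_derivative_chi2_score:
  assumes "\<nu> > 0" "l \<ge> 0" "x > 0"
  shows "(chi2_score \<nu> l has_real_derivative
    (1 - \<nu> / 2 - hyp01_curv (\<nu> / 2) (l * x / 4)) / x\<^sup>2) (at x)"
proof (cases "l = 0")
  \<comment> \<open>Here the inner argument is constantly \<open>0\<close>, outside the range of
    \<open>has_real_derivative_hyp01_quot\<close>; the score is elementary instead.\<close>
  case True
  define b where "b = \<nu> / 2 - 1"
  have "chi2_score \<nu> l = (\<lambda>x. (b - x / 2) / x)"
    by (rule ext) (simp add: chi2_score_def b_def True)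
  moreover have "((\<lambda>x. (b - x / 2) / x) has_real_derivative - b / x\<^sup>2) (at x)"
    using assms by (auto intro!: derivative_eq_intros simp: power2_eq_square)
  ultimately show ?thesis by (simp add: True b_def)
next
  case False
  then have l: "l > 0" using assms by simp
  define t where "t = l * x / 4"
  have t: "t > 0" using assms l by (simp add: t_def)
  define w where "w = hyp01_quot (\<nu> / 2)"
  define d where "d = (t + (1 - \<nu> / 2) * w t - (w t)\<^sup>2) / t"
  have w: "(w has_real_derivative d) (at (l * x / 4))"
    using has_real_derivative_hyp01_quot[of "\<nu> / 2" t] t assms by (simp add: w_def d_def t_def)
  have der: "(chi2_score \<nu> l has_real_derivative
      ((d * (l / 4) - 1 / 2) * x - (\<nu> / 2 - 1 + w t - x / 2)) / (x * x)) (at x)"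
    unfolding chi2_score_def w_def[symmetric] using assms
    by (auto intro!: derivative_eq_intros DERIV_chain2[where f = w and g = "\<lambda>x. l * x / 4", OF w]
        simp: t_def)
  have "d * t = w t - hyp01_curv (\<nu> / 2) t"
    using t by (simp add: d_def hyp01_curv_def) (simp add: w_def algebra_simps)
  moreover have "(d * (l / 4) - 1 / 2) * x - (\<nu> / 2 - 1 + w t - x / 2) = d * t + 1 - \<nu> / 2 - w t"
    by (simp add: t_def algebra_simps)
  ultimately have "(d * (l / 4) - 1 / 2) * x - (\<nu> / 2 - 1 + w t - x / 2) =
      1 - \<nu> / 2 - hyp01_curv (\<nu> / 2) t" by simp
  from der[unfolded this] show ?thesis by (simp add: t_def power2_eq_square)
qed

lemma isCont_chi2_score: "\<nu> > 0 \<Longrightarrow> l \<ge> 0 \<Longrightarrow> x > 0 \<Longrightarrow> isCont (chi2_score \<nu> l) x"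
  by (rule DERIV_isCont[OF has_real_derivative_chi2_score])

text \<open>The bound on \<open>K\<close> is asked for strictly between \<open>x\<close> and
  \<open>y\<close> only, since an endpoint may be the point where \<open>K\<close> equals
  \<open>1 - \<nu> / 2\<close>.\<close>

lemma chi2_score_increasing:
  assumes "\<nu> > 0" "l \<ge> 0" "0 < x" "x < y"
    and K: "\<And>z. x < z \<Longrightarrow> z < y \<Longrightarrow> hyp01_curv (\<nu> / 2) (l * z / 4) < 1 - \<nu> / 2"
  shows "chi2_score \<nu> l x < chi2_score \<nu> l y"
proof (rule DERIV_pos_imp_increasing_open[where f = "chi2_score \<nu> l",
      OF assms(4)], intro exI conjI)
  fix z assume z: "x < z" "z < y"
  show "(chi2_score \<nu> l has_real_derivative
      (1 - \<nu> / 2 - hyp01_curv (\<nu> / 2) (l * z / 4)) / z\<^sup>2) (at z)"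
    using assms z by (intro has_real_derivative_chi2_score) auto
  show "(1 - \<nu> / 2 - hyp01_curv (\<nu> / 2) (l * z / 4)) / z\<^sup>2 > 0"
    using K[OF z] z assms(3) by (intro divide_pos_pos) auto
next
  show "continuous_on {x..y} (chi2_score \<nu> l)"
    using assms by (intro continuous_at_imp_continuous_on ballI isCont_chi2_score) auto
qed

lemma chi2_score_decreasing:
  assumes "\<nu> > 0" "l \<ge> 0" "0 < x" "x < y"
    and K: "\<And>z. x < z \<Longrightarrow> z < y \<Longrightarrow> hyp01_curv (\<nu> / 2) (l * z / 4) > 1 - \<nu> / 2"
  shows "chi2_score \<nu> l y < chi2_score \<nu> l x"
proof (rule DERIV_neg_imp_decreasing_open[where f = "chi2_score \<nu> l",
      OF assms(4)], intro exI conjI)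
  fix z assume z: "x < z" "z < y"
  show "(chi2_score \<nu> l has_real_derivative
      (1 - \<nu> / 2 - hyp01_curv (\<nu> / 2) (l * z / 4)) / z\<^sup>2) (at z)"
    using assms z by (intro has_real_derivative_chi2_score) auto
  show "(1 - \<nu> / 2 - hyp01_curv (\<nu> / 2) (l * z / 4)) / z\<^sup>2 < 0"
    using K[OF z] z assms(3) by (intro divide_neg_pos) auto
next
  show "continuous_on {x..y} (chi2_score \<nu> l)"
    using assms by (intro continuous_at_imp_continuous_on ballI isCont_chi2_score) auto
qed

section \<open>Monotonicity of the density from the sign of the score\<close>

lemma continuous_on_ln_density:
  assumes "\<nu> > 0" "l \<ge> 0" "0 < x"
  shows "continuous_on {x..y} (\<lambda>x. ln (noncentral_chi2_density \<nu> l x))"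
proof (intro continuous_at_imp_continuous_on ballI)
  fix z assume "z \<in> {x..y}"
  then have "z > 0" using assms by simp
  from DERIV_isCont[OF has_real_derivative_ln_density[OF assms(1,2) this]]
  show "isCont (\<lambda>x. ln (noncentral_chi2_density \<nu> l x)) z" .
qed

lemma density_increasing:
  assumes "\<nu> > 0" "l \<ge> 0" "0 < x" "x < y"
    and pos: "\<And>z. x < z \<Longrightarrow> z < y \<Longrightarrow> chi2_score \<nu> l z > 0"
  shows "noncentral_chi2_density \<nu> l x < noncentral_chi2_density \<nu> l y"
proof -
  have "ln (noncentral_chi2_density \<nu> l x) < ln (noncentral_chi2_density \<nu> l y)"
  proof (rule DERIV_pos_imp_increasing_open[where f = "\<lambda>x. ln (noncentral_chi2_density \<nu> l x)",
      OF assms(4)], intro exI conjI)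
    fix z assume z: "x < z" "z < y"
    show "((\<lambda>x. ln (noncentral_chi2_density \<nu> l x)) has_real_derivative chi2_score \<nu> l z) (at z)"
      using assms z by (intro has_real_derivative_ln_density) auto
    show "chi2_score \<nu> l z > 0" by (rule pos[OF z])
  next
    show "continuous_on {x..y} (\<lambda>x. ln (noncentral_chi2_density \<nu> l x))"
      by (rule continuous_on_ln_density[OF assms(1-3)])
  qed
  then show ?thesis using noncentral_chi2_density_pos[of \<nu> l] assms by simp
qed

lemma density_decreasing:
  assumes "\<nu> > 0" "l \<ge> 0" "0 < x" "x < y"
    and neg: "\<And>z. x < z \<Longrightarrow> z < y \<Longrightarrow> chi2_score \<nu> l z < 0"
  shows "noncentral_chi2_density \<nu> l y < noncentral_chi2_density \<nu> l x"
proof -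
  have "ln (noncentral_chi2_density \<nu> l y) < ln (noncentral_chi2_density \<nu> l x)"
  proof (rule DERIV_neg_imp_decreasing_open[where f = "\<lambda>x. ln (noncentral_chi2_density \<nu> l x)",
      OF assms(4)], intro exI conjI)
    fix z assume z: "x < z" "z < y"
    show "((\<lambda>x. ln (noncentral_chi2_density \<nu> l x)) has_real_derivative chi2_score \<nu> l z) (at z)"
      using assms z by (intro has_real_derivative_ln_density) auto
    show "chi2_score \<nu> l z < 0" by (rule neg[OF z])
  next
    show "continuous_on {x..y} (\<lambda>x. ln (noncentral_chi2_density \<nu> l x))"
      by (rule continuous_on_ln_density[OF assms(1-3)])
  qed
  then show ?thesis using noncentral_chi2_density_pos[of \<nu> l] assms by simp
qed

lemma strict_antimono_density:
  assumes "\<nu> > 0" "l \<ge> 0" "\<And>z. z > 0 \<Longrightarrow> chi2_score \<nu> l z < 0"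
  shows "strict_antimono_on {0<..} (noncentral_chi2_density \<nu> l)"
  using assms by (intro monotone_onI) (auto intro!: density_decreasing)

lemma not_antimono_density:
  assumes "\<nu> > 0" "l \<ge> 0" "0 < y" "\<And>z. 0 < z \<Longrightarrow> z < y \<Longrightarrow> chi2_score \<nu> l z > 0"
  shows "\<not> strict_antimono_on {0<..} (noncentral_chi2_density \<nu> l)"
proof
  assume "strict_antimono_on {0<..} (noncentral_chi2_density \<nu> l)"
  from monotone_onD[OF this, of "y / 2" y]
  have "noncentral_chi2_density \<nu> l y < noncentral_chi2_density \<nu> l (y / 2)" using assms by simp
  then show False using density_increasing[of \<nu> l "y / 2" y] assms by simp
qed

section \<open>Log-convexity and log-concavity of the density\<close>

lemma strictly_convex_ln_density:
  assumes "\<nu> > 0" "l \<ge> 0" "convex S" "S \<subseteq> {0<..}"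
    and "\<And>x. x \<in> S \<Longrightarrow> hyp01_curv (\<nu> / 2) (l * x / 4) < 1 - \<nu> / 2"
  shows "strictly_convex_on S (\<lambda>x. ln (noncentral_chi2_density \<nu> l x))"
proof (rule strictly_convex_onI_deriv[where f' = "chi2_score \<nu> l", OF assms(3)])
  show "strict_mono_on S (chi2_score \<nu> l)"
  proof (rule strict_mono_onI)
    fix x y assume xy: "x \<in> S" "y \<in> S" "x < y"
    have "z \<in> S" if "x \<le> z" "z \<le> y" for z
      using assms(3) xy that by (meson is_interval_convex_1 mem_is_interval_1_I)
    then show "chi2_score \<nu> l x < chi2_score \<nu> l y"
      using assms(1,2,5) xy subsetD[OF assms(4) xy(1)] by (intro chi2_score_increasing) auto
  qed
qed (use assms has_real_derivative_ln_density in auto)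

lemma strictly_concave_ln_density:
  assumes "\<nu> > 0" "l \<ge> 0" "convex S" "S \<subseteq> {0<..}"
    and "\<And>x. x \<in> S \<Longrightarrow> hyp01_curv (\<nu> / 2) (l * x / 4) > 1 - \<nu> / 2"
  shows "strictly_concave_on S (\<lambda>x. ln (noncentral_chi2_density \<nu> l x))"
  unfolding strictly_concave_on_def
proof (rule strictly_convex_onI_deriv[where f' = "\<lambda>x. - chi2_score \<nu> l x", OF assms(3)])
  show "strict_mono_on S (\<lambda>x. - chi2_score \<nu> l x)"
  proof (rule strict_mono_onI)
    fix x y assume xy: "x \<in> S" "y \<in> S" "x < y"
    have "z \<in> S" if "x \<le> z" "z \<le> y" for z
      using assms(3) xy that by (meson is_interval_convex_1 mem_is_interval_1_I)
    then have "chi2_score \<nu> l x > chi2_score \<nu> l y"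
      using assms(1,2,5) xy subsetD[OF assms(4) xy(1)] by (intro chi2_score_decreasing) auto
    then show "- chi2_score \<nu> l x < - chi2_score \<nu> l y" by simp
  qed
qed (use assms has_real_derivative_ln_density in \<open>auto intro!: DERIV_minus\<close>)

text \<open>Here \<open>1 - \<nu> / 2 \<le> 0 \<le> K\<close>, so the derivative of the score is
  nonpositive.\<close>

lemma log_concave_density:
  assumes "\<nu> \<ge> 2" "l \<ge> 0"
  shows "log_concave (noncentral_chi2_density \<nu> l)"
  unfolding log_concave_def
proof (rule f''_le0_imp_concave)
  fix x :: real assume "x \<in> {0<..}"
  then have x: "x > 0" by simp
  show "((\<lambda>x. ln (noncentral_chi2_density \<nu> l x)) has_real_derivative chi2_score \<nu> l x) (at x)"
    using assms x by (intro has_real_derivative_ln_density) auto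
  show "(chi2_score \<nu> l has_real_derivative
      (1 - \<nu> / 2 - hyp01_curv (\<nu> / 2) (l * x / 4)) / x\<^sup>2) (at x)"
    using assms x by (intro has_real_derivative_chi2_score) auto
  have "hyp01_curv (\<nu> / 2) (l * x / 4) \<ge> 0"
    using hyp01_curv_pos[of "\<nu> / 2" "l * x / 4"] assms x by (cases "l = 0") auto
  then show "(1 - \<nu> / 2 - hyp01_curv (\<nu> / 2) (l * x / 4)) / x\<^sup>2 \<le> 0"
    using assms x by (simp add: divide_le_0_iff)
qed auto

text \<open>At the antimode \<open>m\<close> the function is smaller than at both
  \<open>m / 2\<close> and \<open>M\<close>, which concavity of the logarithm forbids.\<close>

lemma log_concave_imp_not_bimodal:
  assumes lc: "log_concave f" and pos: "\<And>x. x > 0 \<Longrightarrow> f x > 0"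
  shows "\<not> bimodal f"
proof
  assume "bimodal f"
  then obtain m M where m: "0 < m" "m < M" "strict_antimono_on {0<..m} f" "strict_mono_on {m..M} f"
    unfolding bimodal_def by blast
  have "f m < f (m / 2)" "f m < f M"
    using monotone_onD[OF m(3), of "m / 2" m] monotone_onD[OF m(4), of m M] m by auto
  then have less: "ln (f m) < ln (f (m / 2))" "ln (f m) < ln (f M)"
    using pos m by auto
  \<comment> \<open>The weight that makes \<open>m\<close> the convex combination of
    \<open>m / 2\<close> and \<open>M\<close>.\<close>
  define s where "s = (m / 2) / (M - m / 2)"
  have s: "0 < s" "s < 1" using m by (auto simp: s_def field_simps)
  have "M - m / 2 \<noteq> 0" using m by simp
  from nonzero_eq_divide_eq[OF this, of s "m / 2"] have "s * (M - m / 2) = m / 2"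
    by (simp add: s_def)
  then have "(1 - s) * (m / 2) + s * M = m" by (simp add: field_simps)
  then have "(1 - s) * ln (f (m / 2)) + s * ln (f M) \<le> ln (f m)"
    using concave_onD[OF lc[unfolded log_concave_def], of s "m / 2" M] s m by simp
  moreover have "(1 - s) * ln (f m) < (1 - s) * ln (f (m / 2))" "s * ln (f m) < s * ln (f M)"
    using less s by simp_all
  ultimately show False by (simp add: algebra_simps)
qed

lemma log_concave_imp_not_strictly_convex:
  assumes "log_concave f" "c > 0"
  shows "\<not> strictly_convex_on {0<..<c} (\<lambda>x. ln (f x))"
proof
  assume conv: "strictly_convex_on {0<..<c} (\<lambda>x. ln (f x))"
  have "{0<..<c} \<subseteq> {0<..}" by (simp add: subset_eq)
  from strictly_convex_imp_not_concave[OF conv assms(1)[unfolded log_concave_def] this, of "c / 2" "c / 3"]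
  show False using assms(2) by simp
qed

text \<open>Near \<open>0\<close> the numerator of the score tends to \<open>\<nu> / 2 - 1\<close>,
  which settles \<open>\<nu> > 2\<close>. For \<open>\<nu> = 2\<close> it is
  \<open>w - x / 2\<close>, and \<open>w\<close> behaves like \<open>l * x / 4\<close> there, whence
  the threshold 2.\<close>

lemma density_antimono_iff_ge2:
  assumes "\<nu> \<ge> 2" "l \<ge> 0"
  shows "strict_antimono_on {0<..} (noncentral_chi2_density \<nu> l) \<longleftrightarrow> \<nu> = 2 \<and> l \<le> 2"
proof -
  consider "\<nu> > 2" | "\<nu> = 2" "l > 2" | "\<nu> = 2" "l \<le> 2" using assms by linarith
  then show ?thesis
  proof cases
    case 1
    have "chi2_score \<nu> l z > 0" if "0 < z" "z < \<nu> - 2" for z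
    proof -
      have "hyp01_quot (\<nu> / 2) (l * z / 4) \<ge> 0"
        using hyp01_quot_pos[of "\<nu> / 2" "l * z / 4"] 1 that assms by (cases "l = 0") auto
      then show ?thesis using that by (simp add: chi2_score_def)
    qed
    then show ?thesis using not_antimono_density[of \<nu> l "\<nu> - 2"] 1 assms by simp
  next
    case 2
    \<comment> \<open>Chosen so that \<open>t < e^2\<close> yields \<open>w < e\<close>, whence
      \<open>t < w (1 + w) < w l / 2\<close>, which says \<open>z / 2 < w\<close>.\<close>
    define e where "e = l / 2 - 1"
    have e: "e > 0" using 2 by (simp add: e_def)
    have "chi2_score \<nu> l z > 0" if z: "0 < z" "z < 4 * e\<^sup>2 / l" for z
    proof -
      define t w where "t = l * z / 4" "w = hyp01_quot 1 t"
      have t: "0 < t" "t < e\<^sup>2" using z 2 by (auto simp: t_w_def field_simps)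
      have w: "0 < w" "w\<^sup>2 < t" "t < w + w\<^sup>2"
        using hyp01_quot_pos[of 1 t] hyp01_quot_deriv_pos[of 1 t] hyp01_curv_pos[of 1 t] t
        by (auto simp: t_w_def hyp01_curv_def)
      have "w\<^sup>2 < e\<^sup>2" using w t by linarith
      then have "w < e" using power2_less_imp_less[of w e] e by simp
      then have "w * w < w * e" using w by simp
      then have "t < w * (l / 2)" using w by (simp add: e_def power2_eq_square algebra_simps)
      then have "l * (z / 2) < l * w" by (simp add: t_w_def algebra_simps)
      then have "z / 2 < w" using 2 by simp
      then show ?thesis using z 2 by (simp add: chi2_score_def t_w_def)
    qed
    then show ?thesis using not_antimono_density[of \<nu> l "4 * e\<^sup>2 / l"] 2 e by simp
  next
    case 3
    have "chi2_score \<nu> l z < 0" if "z > 0" for z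
    proof -
      have "hyp01_quot 1 (l * z / 4) < z / 2"
      proof (cases "l = 0")
        case False
        then have "hyp01_quot 1 (l * z / 4) < l * z / 4"
          using hyp01_quot_less[of 1 "l * z / 4"] that assms by simp
        also have "\<dots> \<le> z / 2" using 3 that by simp
        finally show ?thesis .
      qed (use that in simp)
      then show ?thesis using 3 that by (simp add: chi2_score_def divide_less_0_iff)
    qed
    then show ?thesis using strict_antimono_density[of \<nu> l] 3 assms by simp
  qed
qed

section \<open>Fewer than two degrees of freedom\<close>

locale curv_crossing =
  fixes \<nu> t0 :: real
  assumes nu: "0 < \<nu>" "\<nu> < 2" and t0: "t0 > 0" "hyp01_curv (\<nu> / 2) t0 = 1 - \<nu> / 2"
    and before: "\<And>t. 0 \<le> t \<Longrightarrow> t < t0 \<Longrightarrow> hyp01_curv (\<nu> / 2) t < 1 - \<nu> / 2"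
    and after: "\<And>t. t0 < t \<Longrightarrow> hyp01_curv (\<nu> / 2) t > 1 - \<nu> / 2"
begin

definition w0 where "w0 = hyp01_quot (\<nu> / 2) t0"

lemma w0_gt: "w0 > 1 - \<nu> / 2"
  using hyp01_curv_less_quot[of "\<nu> / 2" t0] nu t0 by (simp add: w0_def)

lemma t0_eq: "t0 = (w0 + 1) * (w0 - (1 - \<nu> / 2))"
  using t0(2) unfolding hyp01_curv_def w0_def[symmetric]
  by (simp add: power2_eq_square algebra_simps add_divide_distrib)

text \<open>Put \<open>u = l / 2 - 1\<close>. The argument \<open>l (l + \<nu> - 4) / 4\<close> equals \<open>(u + 1) (u - (1 - \<nu> / 2))\<close>,
  which is increasing in \<open>u\<close> and equals \<open>t0\<close> for \<open>u = w0\<close>.\<close>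

lemma sgn_crit_fun:
  assumes l: "l > 4 - \<nu>"
  shows "sgn (crit_fun \<nu> l) = sgn (l - 2 * (w0 + 1))"
proof -
  define a u t where "a = \<nu> / 2" "u = l / 2 - 1" "t = l * (l + \<nu> - 4) / 4"
  define w where "w = hyp01_quot a t"
  define z where "z = sqrt (l * (l + \<nu> - 4))"
  have u: "u > 1 - a" "u > 0" "a > 0" using l nu by (auto simp: a_u_t_def)
  have t: "t > 0" using l nu by (simp add: a_u_t_def)
  have z: "z > 0" "z\<^sup>2 = 4 * t" using l nu by (simp_all add: z_def a_u_t_def)
  have t_eq: "t = (u + 1) * (u - (1 - a))" by (simp add: a_u_t_def field_simps)
  have "crit_fun \<nu> l = 2 * w / z - 2 * u / z"
    using bessel_ratio_eq[of a z] z u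
    by (simp add: crit_fun_def w_def flip: z_def) (simp add: a_u_t_def)
  also have "\<dots> = 2 / z * (w - u)" by (simp add: right_diff_distrib)
  finally have "sgn (crit_fun \<nu> l) = sgn (2 / z * (w - u))" by (rule arg_cong)
  also have "\<dots> = sgn (2 / z) * sgn (w - u)" by (rule sgn_mult)
  also have "\<dots> = sgn (w - u)" using z by simp
  \<comment> \<open>The positive factor \<open>w + u + a\<close> completes the difference to
    \<open>K - (1 - a)\<close>, whose sign is that of \<open>t - t0\<close>.\<close>
  also have "\<dots> = sgn ((w - u) * (w + u + a))"
    using hyp01_quot_pos[of a t] u t by (simp add: sgn_mult w_def)
  also have "(w - u) * (w + u + a) = hyp01_curv a t - (1 - a)"
    unfolding hyp01_curv_def w_def[symmetric] by (subst t_eq) (simp add: power2_eq_square algebra_simps)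
  also have "sgn \<dots> = sgn (t - t0)"
    using before[of t] after[of t] t0 t by (cases t t0 rule: linorder_cases) (auto simp: a_u_t_def)
  also have "t - t0 = (u - w0) * (u + w0 + a)"
    by (subst t_eq, subst t0_eq) (simp add: a_u_t_def algebra_simps)
  also have "sgn \<dots> = sgn (u - w0)"
    using w0_gt u nu by (simp add: sgn_mult)
  also have "u - w0 = (l - 2 * (w0 + 1)) / 2" by (simp add: a_u_t_def field_simps)
  also have "sgn \<dots> = sgn (l - 2 * (w0 + 1))" by (simp add: sgn_divide)
  finally show ?thesis .
qed

lemma crit_value_eq: "crit_value \<nu> = 2 * (w0 + 1)"
proof -
  let ?c = "2 * (w0 + 1)"
  have c: "?c > 4 - \<nu>" using w0_gt by simp
  have pos: "crit_fun \<nu> l > 0 \<longleftrightarrow> l > ?c" and neg: "crit_fun \<nu> l < 0 \<longleftrightarrow> l < ?c"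
    if "l > 4 - \<nu>" for l
    using sgn_crit_fun[OF that]
    by (metis sgn_greater diff_gt_0_iff_gt, metis sgn_less diff_less_0_iff_less)
  have "(THE c. c > 4 - \<nu> \<and> (\<forall>l. c < l \<longrightarrow> crit_fun \<nu> l > 0) \<and>
      (\<forall>l. 4 - \<nu> < l \<and> l < c \<longrightarrow> crit_fun \<nu> l < 0)) = ?c"
  proof (rule the_equality)
    fix c assume *: "c > 4 - \<nu> \<and> (\<forall>l. c < l \<longrightarrow> crit_fun \<nu> l > 0) \<and>
      (\<forall>l. 4 - \<nu> < l \<and> l < c \<longrightarrow> crit_fun \<nu> l < 0)"
    \<comment> \<open>At the midpoint of two distinct candidates \<open>crit_fun\<close> would need
      both signs.\<close>
    define d where "d = (c + ?c) / 2"
    have "d > 4 - \<nu>" using * c by (simp add: d_def)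
    then show "c = ?c"
      using * pos[of d] neg[of d] by (cases c ?c rule: linorder_cases) (auto simp: d_def)
  qed (use c pos neg in auto)
  then show ?thesis using nu by (simp add: crit_value_def)
qed

context
  fixes l :: real
  assumes l: "l > 0"
begin

definition x0 where "x0 = 4 * t0 / l"

lemma x0_pos: "x0 > 0" using t0 l by (simp add: x0_def)

lemma strictly_convex_then_concave:
  "strictly_convex_on {0<..<x0} (\<lambda>x. ln (noncentral_chi2_density \<nu> l x))"
  "strictly_concave_on {x0<..} (\<lambda>x. ln (noncentral_chi2_density \<nu> l x))"
  using l nu x0_pos
  by (intro strictly_convex_ln_density strictly_concave_ln_density before after;
      auto simp: x0_def field_simps)+

lemma chi2_score_increasing_before:
  assumes "0 < x" "x < y" "y \<le> x0"
  shows "chi2_score \<nu> l x < chi2_score \<nu> l y"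
proof (rule chi2_score_increasing)
  fix z assume z: "x < z" "z < y"
  then have "l * z < l * x0" using assms l by simp
  then have "l * z / 4 < t0" using l by (simp add: x0_def)
  then show "hyp01_curv (\<nu> / 2) (l * z / 4) < 1 - \<nu> / 2"
    using z assms l by (intro before) auto
qed (use assms nu l in auto)

lemma chi2_score_decreasing_after:
  assumes "x0 \<le> x" "x < y"
  shows "chi2_score \<nu> l y < chi2_score \<nu> l x"
proof (rule chi2_score_decreasing)
  fix z assume z: "x < z" "z < y"
  then have "l * z > l * x0" using assms l by simp
  then have "l * z / 4 > t0" using l by (simp add: x0_def)
  then show "hyp01_curv (\<nu> / 2) (l * z / 4) > 1 - \<nu> / 2" by (rule after)
qed (use assms nu l x0_pos in auto)

text \<open>At \<open>x0\<close> the term \<open>x / 2\<close> is \<open>2 * t0 / l\<close>, and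
  \<open>t0_eq\<close> lets the positive factor \<open>w0 - (1 - \<nu> / 2)\<close> be pulled
  out.\<close>

lemma sgn_chi2_score_x0: "sgn (chi2_score \<nu> l x0) = sgn (l - crit_value \<nu>)"
proof -
  have "l * x0 / 4 = t0" using l by (simp add: x0_def)
  then have "chi2_score \<nu> l x0 = (w0 - (1 - \<nu> / 2) - 2 * t0 / l) / x0"
    by (simp add: chi2_score_def w0_def x0_def)
  also have "w0 - (1 - \<nu> / 2) - 2 * t0 / l = (w0 - (1 - \<nu> / 2)) * (l - 2 * (w0 + 1)) / l"
    by (subst t0_eq) (use l in \<open>simp add: field_simps\<close>)
  also have "sgn (\<dots> / x0) = sgn (l - 2 * (w0 + 1))"
    using w0_gt l x0_pos by (simp add: sgn_mult sgn_divide)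
  finally show ?thesis by (simp add: crit_value_eq)
qed

text \<open>The score is largest at \<open>x0\<close>, so it is negative everywhere else. It
  vanishes at \<open>x0\<close> when \<open>l\<close> is critical; gluing the two sides there keeps
  strictness.\<close>

lemma density_antimono:
  assumes "l \<le> crit_value \<nu>"
  shows "strict_antimono_on {0<..} (noncentral_chi2_density \<nu> l)"
proof (rule monotone_onI)
  have "sgn (chi2_score \<nu> l x0) \<le> 0" using assms sgn_chi2_score_x0 by (simp add: sgn_if)
  then have "chi2_score \<nu> l x0 \<le> 0" by (simp add: sgn_if split: if_splits)
  then have neg: "chi2_score \<nu> l z < 0" if "z > 0" "z \<noteq> x0" for z
    using chi2_score_increasing_before[of z x0] chi2_score_decreasing_after[of x0 z] that by linarith
  fix x y :: real assume *: "x \<in> {0<..}" "y \<in> {0<..}" "x < y"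
  have dec: "noncentral_chi2_density \<nu> l q < noncentral_chi2_density \<nu> l p"
    if "0 < p" "p < q" "q \<le> x0 \<or> x0 \<le> p" for p q
    using that nu l neg by (intro density_decreasing) auto
  show "noncentral_chi2_density \<nu> l y < noncentral_chi2_density \<nu> l x"
  proof (cases "x < x0 \<and> x0 < y")
    case True
    then show ?thesis using dec[of x x0] dec[of x0 y] * x0_pos by simp
  qed (use dec[of x y] * in auto)
qed

text \<open>The score is positive at its maximum \<open>x0\<close> and negative at some
  \<open>p\<close> before and \<open>q\<close> after it; its zeros on either side are the antimode
  and the mode.\<close>

lemma density_bimodal:
  assumes "l > crit_value \<nu>"
  shows "bimodal (noncentral_chi2_density \<nu> l)"
proof -
  have "sgn (chi2_score \<nu> l x0) = 1" using assms sgn_chi2_score_x0 by simp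
  then have pos: "chi2_score \<nu> l x0 > 0" by (simp add: sgn_if split: if_splits)
  define a where "a = \<nu> / 2"
  have a: "0 < a" "a < 1" using nu by (auto simp: a_def)
  define w where "w = (\<lambda>x. hyp01_quot a (l * x / 4))"
  have w: "w x > 0" "a * w x < l * x / 4" "w x * (w x - (1 - a)) < l * x / 4" if "x > 0" for x
    using hyp01_quot_pos[of a "l * x / 4"] hyp01_quot_less[of a "l * x / 4"]
      hyp01_quot_deriv_pos[of a "l * x / 4"] a l that
    by (auto simp: w_def power2_eq_square algebra_simps)
  have score: "chi2_score \<nu> l x = (w x - (1 - a) - x / 2) / x" for x
    by (simp add: chi2_score_def w_def a_def algebra_simps)
  \<comment> \<open>The bound \<open>a * w x < l * x / 4\<close> forces \<open>w p < 1 - a\<close>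
    once \<open>p \<le> 4 * a * (1 - a) / l\<close>.\<close>
  define p where "p = min x0 (4 * a * (1 - a) / l)"
  have p: "0 < p" "p \<le> x0" "chi2_score \<nu> l p < 0"
  proof -
    show "0 < p" using x0_pos a l by (simp add: p_def)
    have "l * p / 4 \<le> a * (1 - a)" using l by (auto simp: p_def min_def field_simps)
    then have "a * w p < a * (1 - a)" using w[OF \<open>0 < p\<close>] by linarith
    then have "w p < 1 - a" using a by simp
    then show "chi2_score \<nu> l p < 0" using \<open>0 < p\<close> by (simp add: score divide_less_0_iff)
  qed (simp add: p_def)
  \<comment> \<open>Since \<open>q \<ge> l\<close>, having \<open>w q - (1 - a) \<ge> q / 2\<close>
    would give \<open>w q \<ge> l / 2\<close> and so violate the third bound on
    \<open>w\<close>.\<close>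
  define q where "q = max x0 l"
  have q: "0 < q" "x0 \<le> q" "chi2_score \<nu> l q < 0"
  proof -
    show "0 < q" using x0_pos by (simp add: q_def)
    have "w q - (1 - a) < q / 2"
    proof (rule ccontr)
      assume "\<not> ?thesis"
      then have *: "w q - (1 - a) \<ge> q / 2" by simp
      then have "w q \<ge> l / 2" using a by (simp add: q_def)
      then have "w q * (w q - (1 - a)) \<ge> l / 2 * (q / 2)"
        using * l \<open>0 < q\<close> by (intro mult_mono) auto
      then show False using w(3)[OF \<open>0 < q\<close>] by simp
    qed
    then show "chi2_score \<nu> l q < 0" using \<open>0 < q\<close> by (simp add: score divide_less_0_iff)
  qed (simp add: q_def)
  have cont: "continuous_on {x..y} (chi2_score \<nu> l)" if "0 < x" for x y
    using that nu l by (intro continuous_at_imp_continuous_on ballI isCont_chi2_score) auto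
  obtain m where m: "p \<le> m" "m \<le> x0" "chi2_score \<nu> l m = 0"
    using IVT'[of "chi2_score \<nu> l" p 0 x0] p pos cont by (meson less_imp_le)
  obtain M where M: "x0 \<le> M" "M \<le> q" "chi2_score \<nu> l M = 0"
    using IVT2'[of "chi2_score \<nu> l" q 0 x0] q pos cont x0_pos by (meson less_imp_le)
  have mM: "0 < m" "m < x0" "x0 < M"
    using p m M pos by (auto simp: less_le)
  have 1: "chi2_score \<nu> l z < 0" if "0 < z" "z < m" for z
    using chi2_score_increasing_before[of z m] that m by simp
  have 2: "chi2_score \<nu> l z > 0" if "m < z" "z < M" for z
    using chi2_score_increasing_before[of m z] chi2_score_decreasing_after[of z M] that m M mM
    by (cases "z \<le> x0") auto
  have 3: "chi2_score \<nu> l z < 0" if "M < z" for z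
    using chi2_score_decreasing_after[of M z] that M by simp
  have "strict_antimono_on {0<..m} (noncentral_chi2_density \<nu> l)"
    using nu l 1 by (intro monotone_onI density_decreasing) auto
  moreover have "strict_mono_on {m..M} (noncentral_chi2_density \<nu> l)"
    using nu l 2 mM by (intro strict_mono_onI density_increasing) auto
  moreover have "strict_antimono_on {M..} (noncentral_chi2_density \<nu> l)"
    using nu l 3 mM by (intro monotone_onI density_decreasing) auto
  ultimately show ?thesis unfolding bimodal_def using mM by (intro exI[of _ m] exI[of _ M]) auto
qed

end

end

section \<open>Assembling the four characterisations\<close>

lemma bimodal_imp_not_antimono:
  assumes "bimodal f"
  shows "\<not> strict_antimono_on {0<..} f"
proof
  assume f: "strict_antimono_on {0<..} f"
  obtain m M where m: "0 < m" "m < M" "strict_mono_on {m..M} f"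
    using assms unfolding bimodal_def by blast
  show False
    using monotone_onD[OF f, of m M] monotone_onD[OF m(3), of m M] m by simp
qed

theorem theorem1:
  fixes \<nu> l :: real
  assumes "\<nu> > 0" and "l \<ge> 0"
  shows "(log_concave (noncentral_chi2_density \<nu> l) \<longleftrightarrow> \<nu> \<ge> 2) \<and>
         ((\<exists>c>0. strictly_convex_on {0<..<c} (\<lambda>x. ln (noncentral_chi2_density \<nu> l x)) \<and>
                 strictly_concave_on {c<..} (\<lambda>x. ln (noncentral_chi2_density \<nu> l x))) \<longleftrightarrow>
            0 < \<nu> \<and> \<nu> < 2 \<and> l > 0) \<and>
         (strict_antimono_on {0<..} (noncentral_chi2_density \<nu> l) \<longleftrightarrow>
            0 < \<nu> \<and> \<nu> \<le> 2 \<and> l \<le> crit_value \<nu>) \<and>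
         (bimodal (noncentral_chi2_density \<nu> l) \<longleftrightarrow>
            0 < \<nu> \<and> \<nu> < 2 \<and> l > crit_value \<nu>)"
proof (cases "\<nu> \<ge> 2")
  case True
  let ?p = "noncentral_chi2_density \<nu> l"
  have lc: "log_concave ?p" using log_concave_density True assms by blast
  have "\<not> strictly_convex_on {0<..<c} (\<lambda>x. ln (?p x))" if "c > 0" for c
    using log_concave_imp_not_strictly_convex[OF lc that] .
  moreover have "\<not> bimodal ?p"
    using log_concave_imp_not_bimodal[OF lc] noncentral_chi2_density_pos assms by blast
  moreover have "strict_antimono_on {0<..} ?p \<longleftrightarrow> \<nu> \<le> 2 \<and> l \<le> crit_value \<nu>"
    using density_antimono_iff_ge2[of \<nu> l] True assms by (auto simp: crit_value_def)
  ultimately show ?thesis using True assms lc by auto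
next
  case False
  let ?p = "noncentral_chi2_density \<nu> l"
  obtain t0 where "t0 > 0" "hyp01_curv (\<nu> / 2) t0 = 1 - \<nu> / 2"
    "\<And>t. 0 \<le> t \<Longrightarrow> t < t0 \<Longrightarrow> hyp01_curv (\<nu> / 2) t < 1 - \<nu> / 2"
    "\<And>t. t0 < t \<Longrightarrow> hyp01_curv (\<nu> / 2) t > 1 - \<nu> / 2"
    using hyp01_curv_crossing[of "\<nu> / 2"] False assms by auto
  then interpret curv_crossing \<nu> t0 using False assms by unfold_locales auto
  \<comment> \<open>In the central case \<open>K\<close> is \<open>0\<close> throughout, so there is
    no concave part.\<close>
  have convex: "strictly_convex_on {0<..} (\<lambda>x. ln (?p x))" if "l = 0"
    using that nu by (intro strictly_convex_ln_density) auto
  have "\<not> log_concave ?p"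
  proof
    assume lc: "log_concave ?p"
    obtain c where c: "c > 0" "strictly_convex_on {0<..<c} (\<lambda>x. ln (?p x))"
    proof (cases "l = 0")
      case True
      then show ?thesis
        using that[of 1] strictly_convex_on_subset[OF convex, of "{0<..<1}"]
        by (simp add: subset_eq)
    next
      case False
      then show ?thesis
        using that x0_pos strictly_convex_then_concave assms by (metis less_eq_real_def)
    qed
    then show False using log_concave_imp_not_strictly_convex[OF lc] by blast
  qed
  moreover have "(\<exists>c>0. strictly_convex_on {0<..<c} (\<lambda>x. ln (?p x)) \<and>
      strictly_concave_on {c<..} (\<lambda>x. ln (?p x))) \<longleftrightarrow> l > 0" (is "?shape \<longleftrightarrow> _")
  proof
    assume ?shape
    then obtain c where c: "c > 0" "strictly_concave_on {c<..} (\<lambda>x. ln (?p x))" by blast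
    show "l > 0"
    proof (rule ccontr)
      assume "\<not> l > 0"
      then have "strictly_convex_on {c<..} (\<lambda>x. ln (?p x))"
        using assms c by (intro strictly_convex_on_subset[OF convex]) auto
      then show False
        using strictly_convex_imp_not_concave[OF _ strictly_concave_imp_concave[OF c(2)], of "{c<..}" "c + 1" "c + 2"]
        by auto
    qed
  next
    assume "l > 0"
    then show ?shape using x0_pos strictly_convex_then_concave by blast
  qed
  moreover have anti: "strict_antimono_on {0<..} ?p" if "l \<le> crit_value \<nu>"
  proof (cases "l = 0")
    case True
    then show ?thesis using nu
      by (intro strict_antimono_density) (auto simp: chi2_score_def divide_less_0_iff)
  qed (use density_antimono that assms in auto)
  \<comment> \<open>The critical value exceeds \<open>4 - \<nu>\<close>, so \<open>l\<close> is
    positive as \<open>density_bimodal\<close> demands.\<close>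
  moreover have bi: "bimodal ?p" if "l > crit_value \<nu>"
    using that density_bimodal w0_gt nu by (simp add: crit_value_eq)
  \<comment> \<open>Decreasing and bi-modal exclude each other, and one of the two conditions on
    \<open>l\<close> always holds, so \<open>anti\<close> and \<open>bi\<close> become
    equivalences.\<close>
  ultimately show ?thesis
    using False assms bimodal_imp_not_antimono[of ?p] by (auto simp: not_le intro: ccontr)
qed

end
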